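(* Let $r\ge 3$ and let $k$ be an integer with $1\le k\le r$. Then $\mathrm{cov}(r,k)=1$.
   Context: A complete $r$-uniform $r$-partite hypergraph $K$ has a vertex set $V=V(K)$ partitioned into nonempty classes $V_1\cup\dots\cup V_r$, and its edges are exactly the sets containing one vertex from each class. A $k$-coloring of a hypergraph is an assignment of a color from $[k]=\{1,\dots,k\}$ to each edge (not all $k$ colors need be used). A coloring is spanning if every vertex is incident to edges of every color used in the coloring. For an edge-colored hypergraph $H$, let $H_i$ be the subhypergraph on vertex set $V(H)$ consisting of the edges of color $i$. A hypergraph is connected if it has only one vertex or any two distinct vertices can be connected by a sequence of edges each intersecting the next; every hypergraph is uniquely partitioned into connected components. A monochromatic component of $H$ is (the vertex set of) a connected component of $H_i$ for some color $i$. Let $c(H)$ be the minimum integer $m$ such that $V(H)$ can be covered by $m$ monochromatic components of $H$. $\mathrm{cov}(r,k)$ is the maximum of $c(K)$ when $K$ ranges over all spanning $k$-colorings of complete $r$-uniform $r$-partite hypergraphs. *)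

theory Defs
  imports Main "HOL-Library.Disjoint_Sets" "HOL-Library.Infinite_Typeclass"
begin

type_synonym 'a hypergraph = "'a set \<times> 'a set set"

abbreviation verts :: "'a hypergraph \<Rightarrow> 'a set" where
  "verts H \<equiv> fst H"

abbreviation edges :: "'a hypergraph \<Rightarrow> 'a set set" where
  "edges H \<equiv> snd H"

(* The vertex set may be infinite.  Nonemptiness of the classes is part of partition_on. *)
definition complete_partite :: "nat \<Rightarrow> 'a hypergraph \<Rightarrow> bool" where
  "complete_partite r H \<longleftrightarrow>
     (\<exists>P. partition_on (verts H) P \<and> finite P \<and> card P = r \<and>
          edges H = {e. e \<subseteq> verts H \<and> (\<forall>A\<in>P. \<exists>!x. x \<in> e \<inter> A)})"

(* Only the values of f on the edges of H are relevant. *)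
definition coloring :: "nat \<Rightarrow> 'a hypergraph \<Rightarrow> ('a set \<Rightarrow> nat) \<Rightarrow> bool" where
  "coloring k H f \<longleftrightarrow> (\<forall>e\<in>edges H. f e \<in> {1..k})"

definition spanning :: "'a hypergraph \<Rightarrow> ('a set \<Rightarrow> nat) \<Rightarrow> bool" where
  "spanning H f \<longleftrightarrow> (\<forall>v\<in>verts H. \<forall>i\<in>f ` edges H. \<exists>e\<in>edges H. v \<in> e \<and> f e = i)"

definition color_subgraph :: "'a hypergraph \<Rightarrow> ('a set \<Rightarrow> nat) \<Rightarrow> nat \<Rightarrow> 'a hypergraph" where
  "color_subgraph H f i = (verts H, {e \<in> edges H. f e = i})"

definition linked :: "'a hypergraph \<Rightarrow> 'a \<Rightarrow> 'a \<Rightarrow> bool" where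
  "linked H x y \<longleftrightarrow> x = y \<or>
     (\<exists>es. es \<noteq> [] \<and> set es \<subseteq> edges H \<and> x \<in> hd es \<and> y \<in> last es \<and>
           successively (\<lambda>e e'. e \<inter> e' \<noteq> {}) es)"

(* Vertex sets of the connected components; a vertex lying in no edge is a component by itself. *)
definition components :: "'a hypergraph \<Rightarrow> 'a set set" where
  "components H = verts H // {(x, y). x \<in> verts H \<and> y \<in> verts H \<and> linked H x y}"

lemma linked_sym: "linked H x y \<Longrightarrow> linked H y x"
proof -
  assume "linked H x y"
  then consider "x = y" | es where "es \<noteq> []" "set es \<subseteq> edges H" "x \<in> hd es" "y \<in> last es"
      "successively (\<lambda>e e'. e \<inter> e' \<noteq> {}) es"
    unfolding linked_def by blast
  then show ?thesis
  proof cases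
    case 2
    then have "rev es \<noteq> [] \<and> set (rev es) \<subseteq> edges H \<and> y \<in> hd (rev es) \<and> x \<in> last (rev es) \<and>
        successively (\<lambda>e e'. e \<inter> e' \<noteq> {}) (rev es)"
      by (simp add: hd_rev last_rev successively_rev Int_commute)
    then show ?thesis unfolding linked_def by blast
  qed (simp add: linked_def)
qed

lemma linked_trans: "linked H x y \<Longrightarrow> linked H y z \<Longrightarrow> linked H x z"
proof -
  assume *: "linked H x y" "linked H y z"
  show ?thesis
  proof (cases "x = y \<or> y = z")
    case False
    from * False obtain es where es: "es \<noteq> []" "set es \<subseteq> edges H" "x \<in> hd es" "y \<in> last es"
      "successively (\<lambda>e e'. e \<inter> e' \<noteq> {}) es" unfolding linked_def by blast
    from * False obtain fs where fs: "fs \<noteq> []" "set fs \<subseteq> edges H" "y \<in> hd fs" "z \<in> last fs"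
      "successively (\<lambda>e e'. e \<inter> e' \<noteq> {}) fs" unfolding linked_def by blast
    have "es @ fs \<noteq> [] \<and> set (es @ fs) \<subseteq> edges H \<and> x \<in> hd (es @ fs) \<and> z \<in> last (es @ fs) \<and>
        successively (\<lambda>e e'. e \<inter> e' \<noteq> {}) (es @ fs)"
      using es fs by (auto simp: successively_append_iff)
    then show ?thesis unfolding linked_def by blast
  qed (use * in auto)
qed

lemma partition_on_components: "partition_on (verts H) (components H)"
  unfolding components_def
  by (intro partition_on_quotient equivI refl_onI symI transI)
     (auto intro: linked_sym linked_trans simp: linked_def[of H x x for x])

definition mono_components :: "nat \<Rightarrow> 'a hypergraph \<Rightarrow> ('a set \<Rightarrow> nat) \<Rightarrow> 'a set set" where
  "mono_components k H f = (\<Union>i\<in>{1..k}. components (color_subgraph H f i))"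

definition cover_number :: "nat \<Rightarrow> 'a hypergraph \<Rightarrow> ('a set \<Rightarrow> nat) \<Rightarrow> nat" where
  "cover_number k H f =
     (LEAST m. \<exists>C \<subseteq> mono_components k H f. finite C \<and> card C = m \<and> \<Union>C = verts H)"

(* The type argument fixes the supply of vertices; every finite hypergraph has a copy over
   any infinite type.  For r \<ge> 2 the cover numbers below are all at most 2 * k, since the
   monochromatic components containing one of two given vertices from different classes
   cover everything, so LEAST and Max are taken over nonempty sets and finite sets
   respectively. *)
definition cov :: "'a itself \<Rightarrow> nat \<Rightarrow> nat \<Rightarrow> nat" where
  "cov _ r k = Max {cover_number k K f | (K :: 'a hypergraph) f.
                      complete_partite r K \<and> coloring k K f \<and> spanning K f}"

end

theory Submission
  imports Defs
begin

text \<open>Suppose that no color class is connected. Then each color \<open>i\<close> splits the vertex set in two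
sides without crossing edges of color \<open>i\<close>, and both sides meet every class because the coloring is
spanning. It is enough to choose one vertex from every class such that the resulting edge crosses
all these splits. A class can be used to cross one prescribed split relative to a fixed vertex;
this handles \<open>r - 1\<close> colors. To gain the last one, two of the vertices are chosen on different
sides of two splits at once: if vertices of distinct classes always agreed in all splits but one,
then for \<open>v\<close> in the first class, a vertex of the second class separated from \<open>v\<close> by the first
split and a vertex of the third class separated from \<open>v\<close> by the second split would differ in
both.\<close>

lemma linked_in_edge:
  assumes "e \<in> edges H" "x \<in> e" "y \<in> e"
  shows "linked H x y"
  unfolding linked_def by (rule disjI2, rule exI[of _ "[e]"]) (use assms in simp)

text \<open>Nonemptiness is a genuine condition: the quotient of the empty set has no classes at
  all.\<close>

lemma verts_in_components_iff:
  "verts H \<in> components H \<longleftrightarrow>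
     verts H \<noteq> {} \<and> (\<forall>x\<in>verts H. \<forall>y\<in>verts H. linked H x y)"
proof
  assume A: "verts H \<in> components H"
  then obtain x where "x \<in> verts H" and x: "verts H = {y. x \<in> verts H \<and> y \<in> verts H \<and> linked H x y}"
    unfolding components_def by (elim quotientE) auto
  then show "verts H \<noteq> {} \<and> (\<forall>x\<in>verts H. \<forall>y\<in>verts H. linked H x y)"
    by (blast intro: linked_sym linked_trans)
next
  assume A: "verts H \<noteq> {} \<and> (\<forall>x\<in>verts H. \<forall>y\<in>verts H. linked H x y)"
  then obtain x where x: "x \<in> verts H" by blast
  then have "verts H = {(x, y). x \<in> verts H \<and> y \<in> verts H \<and> linked H x y} `` {x}"
    using A by auto
  then show "verts H \<in> components H"
    unfolding components_def using x by (metis (no_types, lifting) quotientI)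
qed

lemma two_splits_at_once:
  fixes D :: "'i \<Rightarrow> 'a \<Rightarrow> bool"
  assumes "A \<noteq> {}" and ij: "i \<noteq> j"
    and both: "\<And>X l b. X \<in> {B, C} \<Longrightarrow> l \<in> {i, j} \<Longrightarrow> \<exists>v\<in>X. D l v = b"
  obtains X Y v w where "(X, Y) \<in> {(A, B), (A, C), (B, C)}" "v \<in> X" "w \<in> Y"
    "D i v \<noteq> D i w" "D j v \<noteq> D j w"
proof -
  obtain v where v: "v \<in> A" using \<open>A \<noteq> {}\<close> by blast
  obtain u where u: "u \<in> B" "D i u \<noteq> D i v" using both[of B i "\<not> D i v"] by auto
  obtain w where w: "w \<in> C" "D j w \<noteq> D j v" using both[of C j "\<not> D j v"] by auto
  \<comment> \<open>In the third case \<open>u\<close> leaves the sides of \<open>v\<close> only for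
    \<open>i\<close> and \<open>w\<close> only for \<open>j\<close>, so \<open>u\<close> and
    \<open>w\<close> differ for both.\<close>
  consider "D j u \<noteq> D j v" | "D i w \<noteq> D i v" | "D j u = D j v" "D i w = D i v" by blast
  then show thesis
  proof cases
    case 1
    then show ?thesis using that[of A B v u] v u by auto
  next
    case 2
    then show ?thesis using that[of A C v w] v w by auto
  next
    case 3
    then show ?thesis using that[of B C u w] u w by auto
  qed
qed

lemma exists_transversal_crossing_splits:
  fixes D :: "'i \<Rightarrow> 'a \<Rightarrow> bool"
  assumes P: "finite P" "card P \<ge> 3" and I: "finite I" "I \<noteq> {}" "card I \<le> card P"
    and both: "\<And>X i b. X \<in> P \<Longrightarrow> i \<in> I \<Longrightarrow> \<exists>v\<in>X. D i v = b"
  shows "\<exists>s. (\<forall>X\<in>P. s X \<in> X) \<and> (\<forall>i\<in>I. \<exists>X\<in>P. \<exists>Y\<in>P. D i (s X) \<noteq> D i (s Y))"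
proof -
  obtain T where "T \<subseteq> P" "card T = 3"
    by (rule obtain_subset_with_card_n[OF P(2)])
  then obtain A B C where ABC: "A \<in> P" "B \<in> P" "C \<in> P" "A \<noteq> B" "A \<noteq> C" "B \<noteq> C"
    by (auto simp: card_3_iff)
  obtain i where i: "i \<in> I" using \<open>I \<noteq> {}\<close> by blast
  have ne: "X \<noteq> {}" if "X \<in> P" for X using both[OF that i] by blast
  \<comment> \<open>\<open>J\<close> holds the splits that the pair \<open>v\<close>,
    \<open>w\<close> may leave uncrossed. The bound is the number of classes other than
    \<open>X\<close> and \<open>Y\<close>, each of which can take care of one split.\<close>
  have "\<exists>X Y v w J. X \<in> P \<and> Y \<in> P \<and> X \<noteq> Y \<and> v \<in> X \<and> w \<in> Y \<and> J \<subseteq> I \<and> card J \<le> card P - 2 \<and>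
          (\<forall>l\<in>I - J. D l v \<noteq> D l w)"
  \<comment> \<open>With a single split there is no second one to gain, but crossing it once leaves
    \<open>J\<close> empty.\<close>
  proof (cases "I = {i}")
    case True
    obtain v where v: "v \<in> A" using ne ABC by blast
    obtain w where "w \<in> B" "D i w \<noteq> D i v" using both[OF ABC(2) i, of "\<not> D i v"] by auto
    with v True ABC show ?thesis
      by (intro exI[of _ A] exI[of _ B] exI[of _ v] exI[of _ w] exI[of _ "{}"]) auto
  next
    case False
    then obtain j where j: "j \<in> I" "i \<noteq> j" using i by blast
    have "\<exists>v\<in>X. D l v = b" if "X \<in> {B, C}" "l \<in> {i, j}" for X l b
      using both[of X l] that ABC i j by auto
    then obtain X Y v w where "(X, Y) \<in> {(A, B), (A, C), (B, C)}" "v \<in> X" "w \<in> Y"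
      "D i v \<noteq> D i w" "D j v \<noteq> D j w"
      using two_splits_at_once[OF ne[OF ABC(1)] j(2), of B C D] by metis
    moreover have "card (I - {i, j}) \<le> card P - 2"
      using i j I by (subst card_Diff_subset) auto
    moreover have "X \<in> P" "Y \<in> P" "X \<noteq> Y" using calculation(1) ABC by auto
    ultimately show ?thesis
      by (intro exI[of _ X] exI[of _ Y] exI[of _ v] exI[of _ w] exI[of _ "I - {i, j}"]) blast
  qed
  then obtain X Y v w J where XY: "X \<in> P" "Y \<in> P" "X \<noteq> Y" "v \<in> X" "w \<in> Y"
    and J: "J \<subseteq> I" "card J \<le> card P - 2" "\<And>l. l \<in> I - J \<Longrightarrow> D l v \<noteq> D l w"
    by blast
  have "card (P - {X, Y}) = card P - 2" using XY P by (subst card_Diff_subset) auto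
  \<comment> \<open>Each remaining split gets a class of its own. Injectivity means that no class
    has to serve two splits.\<close>
  then obtain g where g: "g ` J \<subseteq> P - {X, Y}" "inj_on g J"
    using card_le_inj[of J "P - {X, Y}"] J P I finite_subset[OF J(1)] by auto
  \<comment> \<open>The value of the transversal at \<open>Z\<close>: prescribed on \<open>X\<close>
    and \<open>Y\<close>, and on a class assigned to a split \<open>l\<close> a vertex on the other
    side from \<open>v\<close>. Since \<open>g\<close> avoids \<open>X\<close> and \<open>Y\<close>,
    these demands never clash.\<close>
  have "\<exists>u. u \<in> Z \<and> (Z = X \<longrightarrow> u = v) \<and> (Z = Y \<longrightarrow> u = w) \<and> (\<forall>l\<in>J. g l = Z \<longrightarrow> D l u \<noteq> D l v)"
    if Z: "Z \<in> P" for Z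
  proof (cases "Z \<in> g ` J")
    case True
    then obtain l where l: "l \<in> J" "Z = g l" by blast
    then obtain u where u: "u \<in> Z" "D l u \<noteq> D l v" using both[OF Z, of l "\<not> D l v"] J by auto
    have "\<forall>m\<in>J. g m = Z \<longrightarrow> m = l" using l g by (auto dest: inj_onD)
    moreover have "Z \<noteq> X" "Z \<noteq> Y" using l g by auto
    ultimately show ?thesis using u by blast
  next
    case False
    obtain u where "u \<in> Z" using ne[OF Z] by blast
    with False XY show ?thesis
      by (intro exI[of _ "if Z = X then v else if Z = Y then w else u"]) auto
  qed
  then obtain s where s: "\<And>Z. Z \<in> P \<Longrightarrow> s Z \<in> Z \<and> (Z = X \<longrightarrow> s Z = v) \<and> (Z = Y \<longrightarrow> s Z = w) \<and>
      (\<forall>l\<in>J. g l = Z \<longrightarrow> D l (s Z) \<noteq> D l v)"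
    by (metis (lifting))
  show ?thesis
  proof (intro exI[of _ s] conjI ballI)
    show "s Z \<in> Z" if "Z \<in> P" for Z using s that by blast
    show "\<exists>Z\<in>P. \<exists>W\<in>P. D l (s Z) \<noteq> D l (s W)" if "l \<in> I" for l
    proof (cases "l \<in> J")
      case True
      then have gl: "g l \<in> P" using g by blast
      \<comment> \<open>All remaining splits are crossed relative to the same vertex
        \<open>v\<close>, which is \<open>s X\<close>.\<close>
      have "D l (s (g l)) \<noteq> D l (s X)" using s[OF gl] s[OF XY(1)] True by simp
      then show ?thesis using gl XY(1) by blast
    next
      case False
      then have "D l (s X) \<noteq> D l (s Y)" using s[OF XY(1)] s[OF XY(2)] J(3)[of l] that by simp
      then show ?thesis using XY(1,2) by blast
    qed
  qed
qed

lemma transversal_edge: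
  assumes P: "partition_on V P" and s: "\<And>X. X \<in> P \<Longrightarrow> s X \<in> X"
  shows "s ` P \<subseteq> V" "\<forall>A\<in>P. \<exists>!x. x \<in> s ` P \<inter> A"
proof -
  show "s ` P \<subseteq> V" using s P by (auto simp: partition_on_def)
  \<comment> \<open>A chosen vertex lying in \<open>A\<close> can only come from \<open>A\<close>
    itself, as the classes are disjoint.\<close>
  have "X = A" if "X \<in> P" "A \<in> P" "s X \<in> A" for X A
    using that s[of X] P by (auto simp: partition_on_def disjoint_def)
  then show "\<forall>A\<in>P. \<exists>!x. x \<in> s ` P \<inter> A"
    using s by (intro ballI ex_ex1I) blast+
qed

lemma exists_connected_color:
  assumes K: "complete_partite r K" and "r \<ge> 3" and "k \<le> r"
    and f: "coloring k K f" "spanning K f"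
  shows "\<exists>i\<in>{1..k}. verts K \<in> components (color_subgraph K f i)"
proof (rule ccontr)
  assume contra: "\<not> ?thesis"
  obtain P where P: "partition_on (verts K) P" "finite P" "card P = r"
    and E: "edges K = {e. e \<subseteq> verts K \<and> (\<forall>A\<in>P. \<exists>!x. x \<in> e \<inter> A)}"
    using K unfolding complete_partite_def by blast
  have ne: "\<exists>v. v \<in> X" if "X \<in> P" for X using partition_onD3[OF P(1)] that by (metis ex_in_conv)
  then obtain c where c: "\<And>X. X \<in> P \<Longrightarrow> c X \<in> X" by metis
  have e0: "c ` P \<in> edges K" unfolding E using transversal_edge[OF P(1) c] by simp
  obtain X0 where "X0 \<in> P" using P(3) \<open>r \<ge> 3\<close> by fastforce
  then have V: "verts K \<noteq> {}" using ne[of X0] partition_onD1[OF P(1)] by blast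
  define I where "I = f ` edges K"
  let ?H = "color_subgraph K f"
  have vH: "verts (?H i) = verts K" for i by (simp add: color_subgraph_def)
  have I: "I \<subseteq> {1..k}" using f(1) by (auto simp: I_def coloring_def)
  have "\<exists>x y. x \<in> verts K \<and> y \<in> verts K \<and> \<not> linked (?H i) x y" if "i \<in> I" for i
  proof -
    have "verts (?H i) \<notin> components (?H i)" unfolding vH using contra that I by blast
    then show ?thesis using V verts_in_components_iff[of "?H i"] vH[of i] by metis
  qed
  then obtain x y where xy: "\<And>i. i \<in> I \<Longrightarrow> x i \<in> verts K \<and> y i \<in> verts K \<and> \<not> linked (?H i) (x i) (y i)"
    by metis
  \<comment> \<open>The split of color \<open>i\<close>: the component of \<open>x i\<close> against
    everything else, with \<open>y i\<close> on the far side.\<close>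
  define D where "D i v = linked (?H i) (x i) v" for i v
  have same: "D (f e) u = D (f e) v" if "e \<in> edges K" "u \<in> e" "v \<in> e" for e u v
  proof -
    have "linked (?H (f e)) u v" using that by (intro linked_in_edge[of e]) (auto simp: color_subgraph_def)
    then show ?thesis unfolding D_def using linked_trans linked_sym by metis
  qed
  have both: "\<exists>v\<in>X. D i v = b" if X: "X \<in> P" and i: "i \<in> I" for X i b
  proof -
    \<comment> \<open>A witness for the side \<open>b\<close>. An edge of color \<open>i\<close>
      through \<open>z\<close> stays on that side and meets the class \<open>X\<close>.\<close>
    define z where "z = (if b then x i else y i)"
    have "linked (?H i) (x i) (x i)" by (simp add: linked_def)
    then have z: "z \<in> verts K" "D i z = b" using xy[OF i] by (simp_all add: z_def D_def)
    then obtain e where e: "e \<in> edges K" "z \<in> e" "f e = i"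
      using f(2) i unfolding spanning_def I_def by blast
    have "\<exists>!v. v \<in> e \<inter> X" using e(1) X unfolding E by simp
    then obtain v where v: "v \<in> e" "v \<in> X" by blast
    with same[OF e(1,2) v(1)] z(2) e(3) show ?thesis by (intro bexI[of _ v]) simp_all
  qed
  have "card P \<ge> 3" "finite I" using P \<open>r \<ge> 3\<close> finite_subset[OF I] by auto
  moreover have "I \<noteq> {}" using e0 by (auto simp: I_def)
  moreover have "card I \<le> card P" using card_mono[OF _ I] \<open>k \<le> r\<close> P by simp
  ultimately have "\<exists>s. (\<forall>X\<in>P. s X \<in> X) \<and> (\<forall>i\<in>I. \<exists>X\<in>P. \<exists>Y\<in>P. D i (s X) \<noteq> D i (s Y))"
    using exists_transversal_crossing_splits[where I = I and D = D, OF P(2)] both by blast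
  then obtain s where s: "\<And>X. X \<in> P \<Longrightarrow> s X \<in> X"
    and cross: "\<And>i. i \<in> I \<Longrightarrow> \<exists>X\<in>P. \<exists>Y\<in>P. D i (s X) \<noteq> D i (s Y)"
    by blast
  \<comment> \<open>This edge has some color in \<open>I\<close>, yet it crosses the split of that
    very color, contradicting \<open>same\<close>.\<close>
  have e: "s ` P \<in> edges K" unfolding E using transversal_edge[OF P(1) s] by simp
  then have "f (s ` P) \<in> I" by (auto simp: I_def)
  from cross[OF this] obtain X Y where "X \<in> P" "Y \<in> P" "D (f (s ` P)) (s X) \<noteq> D (f (s ` P)) (s Y)"
    by blast
  with same[OF e, of "s X" "s Y"] show False by blast
qed

lemma cover_number_eq_1:
  assumes "verts K \<noteq> {}" and "i \<in> {1..k}" "verts K \<in> components (color_subgraph K f i)"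
  shows "cover_number k K f = 1"
  unfolding cover_number_def
proof (rule Least_equality)
  show "\<exists>C\<subseteq>mono_components k K f. finite C \<and> card C = 1 \<and> \<Union> C = verts K"
    using assms by (intro exI[of _ "{verts K}"]) (auto simp: mono_components_def)
  \<comment> \<open>The empty family covers only the empty set, which excludes
    \<open>m = 0\<close>.\<close>
  show "1 \<le> m" if "\<exists>C\<subseteq>mono_components k K f. finite C \<and> card C = m \<and> \<Union> C = verts K" for m
    using that assms(1) by (cases m) auto
qed

text \<open>With singleton classes the only transversal is the whole vertex set. This gives an
  example showing that the maximum in \<open>cov\<close> is over a nonempty set.\<close>

lemma single_edge_complete_partite:
  fixes V :: "'a set"
  assumes "finite V"
  shows "complete_partite (card V) (V, {V})"
  unfolding complete_partite_def
proof (intro exI[of _ "(\<lambda>v. {v}) ` V"] conjI)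
  show "partition_on (verts (V, {V})) ((\<lambda>v. {v}) ` V)"
    by (auto simp: partition_on_def disjoint_def)
  show "card ((\<lambda>v. {v}) ` V) = card V" by (simp add: card_image)
  \<comment> \<open>Used below as a rewrite rule; \<open>Int_iff\<close> is removed there so that
    the left-hand side still matches.\<close>
  have "(\<exists>!x. x \<in> e \<inter> {v}) \<longleftrightarrow> v \<in> e" for e and v :: 'a by auto
  then show "edges (V, {V}) = {e. e \<subseteq> verts (V, {V}) \<and> (\<forall>A\<in>(\<lambda>v. {v}) ` V. \<exists>!x. x \<in> e \<inter> A)}"
    by (auto simp del: Int_iff)
qed (use assms in simp)

theorem theorem1p2:
  fixes r k :: nat
  assumes "r \<ge> 3" and "1 \<le> k" and "k \<le> r"
  shows "cov TYPE('a :: infinite) r k = 1"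
proof -
  let ?S = "{cover_number k K f | (K :: 'a hypergraph) f.
               complete_partite r K \<and> coloring k K f \<and> spanning K f}"
  have one: "cover_number k K f = 1"
    if K: "complete_partite r K" "coloring k K f" "spanning K f" for K :: "'a hypergraph" and f
  proof -
    obtain i where i: "i \<in> {1..k}" "verts K \<in> components (color_subgraph K f i)"
      using exists_connected_color[OF K(1) assms(1,3) K(2,3)] by blast
    then have "verts K \<noteq> {}"
      using verts_in_components_iff[of "color_subgraph K f i"] by (simp add: color_subgraph_def)
    with i show ?thesis by (intro cover_number_eq_1)
  qed
  obtain V :: "'a set" where V: "finite V" "card V = r"
    using infinite_arbitrarily_large[OF infinite_UNIV] by blast
  have V1: "complete_partite r (V, {V})" using single_edge_complete_partite[OF V(1)] V(2) by simp
  have V2: "coloring k (V, {V}) (\<lambda>_. 1)" using assms by (simp add: coloring_def)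
  have V3: "spanning (V, {V}) (\<lambda>_. 1)" by (simp add: spanning_def)
  \<comment> \<open>Every admissible coloring has cover number 1 by \<open>one\<close>, and the
    single edge in color 1 supplies an admissible coloring.\<close>
  have "?S = {1}"
  proof (intro equalityI subsetI)
    fix c assume "c \<in> ?S"
    then obtain K :: "'a hypergraph" and f where "c = cover_number k K f"
      and "complete_partite r K" "coloring k K f" "spanning K f"
      by (elim CollectE exE conjE)
    then show "c \<in> {1}" using one[of K f] by simp
  next
    fix c :: nat assume "c \<in> {1}"
    then have "c = cover_number k (V, {V}) (\<lambda>_. 1)" using one[OF V1 V2 V3] by simp
    then show "c \<in> ?S" using V1 V2 V3 by (intro CollectI exI conjI)
  qed
  then show ?thesis unfolding cov_def by simp
qed

end
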